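(* Let $n\ge 1$ be an integer and let $R$ be the free rng on $n$ idempotents, i.e. the rng generated by elements $e_1,\dots,e_n$ subject only to the relations $e_i^2=e_i$ for $i=1,\dots,n$. Then $R$ is generated as a two-sided ideal by a single element, i.e. there is $z\in R$ such that the smallest two-sided ideal of $R$ containing $z$ is $R$ itself.
   Context: A rng is an associative ring that is not required to have a multiplicative unit. The free rng on $n$ idempotents is the (non-unital) rng characterized by the universal property: for any rng $T$ and any idempotents $f_1,\dots,f_n\in T$ there is a unique rng homomorphism $R\to T$ with $e_i\mapsto f_i$ for all $i$. For a subset $Z$ of a rng $R$, the two-sided ideal generated by $Z$ is the additive subgroup of $R$ generated by $Z\cup RZ\cup ZR\cup RZR$. *)

theory Defs
  imports Complex_Main
begin

text \<open>
  The class \<^class>\<open>ring\<close> asks for no multiplicative unit, so its instances are exactly the rngs.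
\<close>

section \<open>Two-sided ideals\<close>

definition add_subgroup :: "'r::ring set \<Rightarrow> bool"
  where "add_subgroup S \<longleftrightarrow> 0 \<in> S \<and> (\<forall>x\<in>S. \<forall>y\<in>S. x + y \<in> S) \<and> (\<forall>x\<in>S. - x \<in> S)"

definition two_sided_ideal :: "'r::ring set \<Rightarrow> bool"
  where "two_sided_ideal J \<longleftrightarrow> add_subgroup J \<and> (\<forall>x\<in>J. \<forall>r. r * x \<in> J \<and> x * r \<in> J)"

text \<open>The set \<open>Z\<close> itself has to be listed among the generators, since it need not lie in \<open>RZR\<close>.\<close>

definition ideal_generated_by :: "'r::ring set \<Rightarrow> 'r set"
  where "ideal_generated_by Z =
    add_subgroup hull
      (Z \<union> {r * z |r z. z \<in> Z} \<union> {z * r |z r. z \<in> Z} \<union> {r * z * s |r z s. z \<in> Z})"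

lemma add_subgroup_hull: "add_subgroup (add_subgroup hull X)"
  by (rule hull_in) (auto simp: add_subgroup_def)

lemma two_sided_ideal_ideal_generated_by: "two_sided_ideal (ideal_generated_by Z)"
proof -
  let ?X = "Z \<union> {r * z |r z. z \<in> Z} \<union> {z * r |z r. z \<in> Z} \<union> {r * z * s |r z s. z \<in> Z}"
  have sg: "add_subgroup (add_subgroup hull ?X)"
    by (rule add_subgroup_hull)
  have "r * x \<in> add_subgroup hull ?X \<and> x * r \<in> add_subgroup hull ?X"
    if "x \<in> add_subgroup hull ?X" for r x
    using that
  proof (rule hull_induct)
    fix y assume "y \<in> ?X"
    then have "r * y \<in> ?X \<and> y * r \<in> ?X"
      by (auto simp: mult.assoc) (metis mult.assoc)+
    then show "r * y \<in> add_subgroup hull ?X \<and> y * r \<in> add_subgroup hull ?X"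
      by (blast intro: hull_inc)
  next
    show "add_subgroup {y. r * y \<in> add_subgroup hull ?X \<and> y * r \<in> add_subgroup hull ?X}"
      using sg by (simp add: add_subgroup_def distrib_left distrib_right)
  qed
  then show ?thesis
    using sg by (auto simp: two_sided_ideal_def ideal_generated_by_def)
qed

lemma ideal_generated_by_smallest: "ideal_generated_by Z = two_sided_ideal hull Z"
proof
  show "two_sided_ideal hull Z \<subseteq> ideal_generated_by Z"
  proof (rule hull_minimal)
    show "Z \<subseteq> ideal_generated_by Z"
      unfolding ideal_generated_by_def by (rule subset_trans[OF _ hull_subset]) blast
  qed (rule two_sided_ideal_ideal_generated_by)
  show "ideal_generated_by Z \<subseteq> two_sided_ideal hull Z"
    unfolding ideal_generated_by_def
  proof (rule hull_minimal)
    have J: "two_sided_ideal (two_sided_ideal hull Z)"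
      by (rule hull_in) (auto simp: two_sided_ideal_def add_subgroup_def)
    then show "add_subgroup (two_sided_ideal hull Z)"
      by (simp add: two_sided_ideal_def)
    have "Z \<subseteq> two_sided_ideal hull Z"
      by (rule hull_subset)
    with J show "Z \<union> {r * z |r z. z \<in> Z} \<union> {z * r |z r. z \<in> Z} \<union> {r * z * s |r z s. z \<in> Z}
        \<subseteq> two_sided_ideal hull Z"
      unfolding two_sided_ideal_def by blast
  qed
qed


section \<open>Rngs presented by idempotents\<close>

text \<open>
  Formal rng expressions in the generators \<open>'i\<close>.  There is no symbol for a unit.
\<close>

datatype 'i rng_expr =
    Gen 'i
  | Zero
  | Plus "'i rng_expr" "'i rng_expr"
  | Minus "'i rng_expr"
  | Times "'i rng_expr" "'i rng_expr"

primrec rng_eval :: "('i \<Rightarrow> 'r::ring) \<Rightarrow> 'i rng_expr \<Rightarrow> 'r"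
  where
    "rng_eval e (Gen i) = e i"
  | "rng_eval e Zero = 0"
  | "rng_eval e (Plus s t) = rng_eval e s + rng_eval e t"
  | "rng_eval e (Minus s) = - rng_eval e s"
  | "rng_eval e (Times s t) = rng_eval e s * rng_eval e t"

text \<open>
  The least congruence on expressions that contains the rng axioms and the relations
  \<open>e\<^sub>i\<^sup>2 = e\<^sub>i\<close>: two expressions are related iff their equality is a consequence of these relations
  in every rng.
\<close>

inductive idem_eq :: "'i rng_expr \<Rightarrow> 'i rng_expr \<Rightarrow> bool"
  where
    refl: "idem_eq s s"
  | sym: "idem_eq s t \<Longrightarrow> idem_eq t s"
  | trans: "idem_eq s t \<Longrightarrow> idem_eq t u \<Longrightarrow> idem_eq s u"
  | Plus_cong: "idem_eq s s' \<Longrightarrow> idem_eq t t' \<Longrightarrow> idem_eq (Plus s t) (Plus s' t')"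
  | Minus_cong: "idem_eq s s' \<Longrightarrow> idem_eq (Minus s) (Minus s')"
  | Times_cong: "idem_eq s s' \<Longrightarrow> idem_eq t t' \<Longrightarrow> idem_eq (Times s t) (Times s' t')"
  | Plus_assoc: "idem_eq (Plus (Plus s t) u) (Plus s (Plus t u))"
  | Plus_comm: "idem_eq (Plus s t) (Plus t s)"
  | Plus_Zero: "idem_eq (Plus Zero s) s"
  | Plus_Minus: "idem_eq (Plus (Minus s) s) Zero"
  | Times_assoc: "idem_eq (Times (Times s t) u) (Times s (Times t u))"
  | Times_distl: "idem_eq (Times s (Plus t u)) (Plus (Times s t) (Times s u))"
  | Times_distr: "idem_eq (Times (Plus s t) u) (Plus (Times s u) (Times t u))"
  | idem: "idem_eq (Times (Gen i) (Gen i)) (Gen i)"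

text \<open>
  The rng \<open>'r\<close> is generated by the elements \<open>e i\<close> with \<open>i \<in> I\<close> (first conjunct), subject only to
  the relations \<open>e i * e i = e i\<close> (second conjunct): the relations that hold between the generators
  are exactly the consequences of these ones.  The values of \<open>e\<close> outside \<open>I\<close> play no role.
\<close>

definition free_rng_on_idempotents :: "'i set \<Rightarrow> ('i \<Rightarrow> 'r::ring) \<Rightarrow> bool"
  where "free_rng_on_idempotents I e \<longleftrightarrow>
    (\<forall>x. \<exists>s. set_rng_expr s \<subseteq> I \<and> x = rng_eval e s) \<and>
    (\<forall>s t. set_rng_expr s \<subseteq> I \<longrightarrow> set_rng_expr t \<subseteq> I \<longrightarrow>
      (rng_eval e s = rng_eval e t \<longleftrightarrow> idem_eq s t))"


subsection \<open>The universal property\<close>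

definition rng_hom :: "('r::ring \<Rightarrow> 't::ring) \<Rightarrow> bool"
  where "rng_hom h \<longleftrightarrow> (\<forall>x y. h (x + y) = h x + h y) \<and> (\<forall>x y. h (x * y) = h x * h y)"

lemma rng_hom_zero: "rng_hom h \<Longrightarrow> h 0 = 0"
  unfolding rng_hom_def by (metis add_cancel_right_right)

lemma rng_hom_minus: "rng_hom h \<Longrightarrow> h (- x) = - h x"
  using rng_hom_zero[of h] unfolding rng_hom_def by (metis add.right_inverse add_eq_0_iff)

lemma rng_hom_eval: "rng_hom h \<Longrightarrow> h (rng_eval e s) = rng_eval (h \<circ> e) s"
  by (induction s) (auto simp: rng_hom_zero rng_hom_minus, auto simp: rng_hom_def)

lemma rng_eval_cong:
  "(\<And>i. i \<in> set_rng_expr s \<Longrightarrow> e i = f i) \<Longrightarrow> rng_eval e s = rng_eval f s"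
  by (induction s) auto

lemma idem_eq_eval:
  assumes "idem_eq s t" and "\<And>i. f i * f i = f i"
  shows "rng_eval f s = rng_eval f t"
  using assms by (induction rule: idem_eq.induct) (auto simp: algebra_simps)

lemma free_rng_on_idempotents_idem:
  assumes "free_rng_on_idempotents I e" and "i \<in> I"
  shows "e i * e i = e i"
proof -
  have "set_rng_expr (Times (Gen i) (Gen i)) \<subseteq> I" and "set_rng_expr (Gen i) \<subseteq> I"
    using assms(2) by auto
  then have "rng_eval e (Times (Gen i) (Gen i)) = rng_eval e (Gen i) \<longleftrightarrow>
      idem_eq (Times (Gen i) (Gen i)) (Gen i)"
    using assms(1) unfolding free_rng_on_idempotents_def by blast
  then show ?thesis
    by (simp add: idem_eq.idem)
qed

theorem free_rng_on_idempotents_universal: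
  fixes e :: "'i \<Rightarrow> 'r::ring" and f :: "'i \<Rightarrow> 't::ring"
  assumes free: "free_rng_on_idempotents I e"
    and f: "\<And>i. i \<in> I \<Longrightarrow> f i * f i = f i"
  shows "\<exists>!h. rng_hom h \<and> (\<forall>i\<in>I. h (e i) = f i)"
proof -
  define g where "g i = (if i \<in> I then f i else 0)" for i
  have g: "g i * g i = g i" for i
    by (simp add: g_def f)
  define rep where "rep x = (SOME s. set_rng_expr s \<subseteq> I \<and> x = rng_eval e s)" for x
  have rep: "set_rng_expr (rep x) \<subseteq> I \<and> x = rng_eval e (rep x)" for x
    unfolding rep_def using free unfolding free_rng_on_idempotents_def
    by (metis (mono_tags, lifting) someI_ex)
  define h where "h x = rng_eval g (rep x)" for x
  have h: "h (rng_eval e s) = rng_eval g s" if "set_rng_expr s \<subseteq> I" for s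
  proof -
    have "idem_eq (rep (rng_eval e s)) s"
      using free rep[of "rng_eval e s"] that unfolding free_rng_on_idempotents_def by metis
    then show ?thesis
      unfolding h_def using g by (rule idem_eq_eval)
  qed
  have "h (x + y) = h x + h y" for x y
    using h[of "Plus (rep x) (rep y)"] rep[of x] rep[of y] by (simp add: h_def)
  moreover have "h (x * y) = h x * h y" for x y
    using h[of "Times (rep x) (rep y)"] rep[of x] rep[of y] by (simp add: h_def)
  ultimately have "rng_hom h"
    by (simp add: rng_hom_def)
  moreover have "h (e i) = f i" if "i \<in> I" for i
    using h[of "Gen i"] that by (simp add: g_def)
  moreover have "h' = h" if "rng_hom h'" and "\<forall>i\<in>I. h' (e i) = f i" for h'
  proof
    fix x
    have "h' x = rng_eval (h' \<circ> e) (rep x)"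
      using rng_hom_eval[OF that(1), of e "rep x"] rep[of x] by simp
    also have "\<dots> = rng_eval g (rep x)"
      using rep[of x] that(2) by (intro rng_eval_cong) (auto simp: g_def)
    finally show "h' x = h x"
      by (simp add: h_def)
  qed
  ultimately show ?thesis
    by blast
qed


subsection \<open>Existence\<close>

text \<open>
  The quotient of the expressions by \<^const>\<open>idem_eq\<close> is free on the generators indexed by the whole
  type \<open>'k\<close>; after reindexing, this gives a free rng on \<open>n\<close> idempotents for each \<open>n = CARD('k)\<close>.
\<close>

quotient_type 'k idem_rng = "'k rng_expr" / idem_eq
  by (auto intro!: equivpI reflpI sympI transpI intro: idem_eq.intros)

instantiation idem_rng :: (type) ring
begin

lift_definition zero_idem_rng :: "'a idem_rng" is Zero .

lift_definition plus_idem_rng :: "'a idem_rng \<Rightarrow> 'a idem_rng \<Rightarrow> 'a idem_rng" is Plus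
  by (rule idem_eq.Plus_cong)

lift_definition uminus_idem_rng :: "'a idem_rng \<Rightarrow> 'a idem_rng" is Minus
  by (rule idem_eq.Minus_cong)

lift_definition minus_idem_rng :: "'a idem_rng \<Rightarrow> 'a idem_rng \<Rightarrow> 'a idem_rng"
  is "\<lambda>s t. Plus s (Minus t)"
  by (intro idem_eq.Plus_cong idem_eq.Minus_cong)

lift_definition times_idem_rng :: "'a idem_rng \<Rightarrow> 'a idem_rng \<Rightarrow> 'a idem_rng" is Times
  by (rule idem_eq.Times_cong)

instance
  by (intro_classes; transfer)
    (rule idem_eq.Plus_assoc idem_eq.Plus_comm idem_eq.Plus_Zero idem_eq.Plus_Minus
      idem_eq.Times_assoc idem_eq.Times_distl idem_eq.Times_distr idem_eq.refl)+

end

lift_definition idem_gen :: "'k \<Rightarrow> 'k idem_rng" is Gen .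

lemma rng_eval_idem_gen: "rng_eval idem_gen s = abs_idem_rng s"
  by (induction s)
    (simp_all add: idem_gen.abs_eq zero_idem_rng.abs_eq plus_idem_rng.abs_eq
      uminus_idem_rng.abs_eq times_idem_rng.abs_eq idem_gen_def)

lemma rng_eval_comp: "rng_eval (e \<circ> b) s = rng_eval e (map_rng_expr b s)"
  by (induction s) auto

lemma idem_eq_map: "idem_eq s t \<Longrightarrow> idem_eq (map_rng_expr b s) (map_rng_expr b t)"
  by (induction rule: idem_eq.induct) (auto intro: idem_eq.intros)

theorem free_rng_on_idempotents_exists:
  fixes b :: "'i \<Rightarrow> 'k"
  assumes b: "bij_betw b I UNIV"
  shows "free_rng_on_idempotents I (idem_gen \<circ> b)"
  unfolding free_rng_on_idempotents_def
proof (intro conjI allI impI)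
  fix x :: "'k idem_rng"
  obtain t where t: "x = abs_idem_rng t"
    by (metis Quotient3_abs_rep Quotient3_idem_rng)
  let ?c = "inv_into I b"
  have "?c k \<in> I \<and> b (?c k) = k" for k
    using b by (metis UNIV_I bij_betw_def f_inv_into_f inv_into_into)
  then have "set_rng_expr (map_rng_expr ?c t) \<subseteq> I" and "map_rng_expr b (map_rng_expr ?c t) = t"
    by (auto simp: rng_expr.set_map rng_expr.map_comp o_def rng_expr.map_ident)
  then show "\<exists>s. set_rng_expr s \<subseteq> I \<and> x = rng_eval (idem_gen \<circ> b) s"
    by (metis t rng_eval_comp rng_eval_idem_gen)
next
  fix s t :: "'i rng_expr"
  assume st: "set_rng_expr s \<subseteq> I" "set_rng_expr t \<subseteq> I"
  let ?c = "inv_into I b"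
  have inv: "map_rng_expr ?c (map_rng_expr b u) = u" if "set_rng_expr u \<subseteq> I" for u
  proof -
    have "map_rng_expr (?c \<circ> b) u = map_rng_expr id u"
      using that b by (intro rng_expr.map_cong) (auto simp: bij_betw_def)
    then show ?thesis
      by (simp add: rng_expr.map_comp rng_expr.map_id)
  qed
  have "rng_eval (idem_gen \<circ> b) s = rng_eval (idem_gen \<circ> b) t \<longleftrightarrow>
      idem_eq (map_rng_expr b s) (map_rng_expr b t)"
    by (simp add: rng_eval_comp rng_eval_idem_gen idem_rng.abs_eq_iff)
  also have "\<dots> \<longleftrightarrow> idem_eq s t"
    using idem_eq_map[of "map_rng_expr b s" "map_rng_expr b t" ?c] idem_eq_map[of s t b]
    by (auto simp: inv st)
  finally show "rng_eval (idem_gen \<circ> b) s = rng_eval (idem_gen \<circ> b) t \<longleftrightarrow> idem_eq s t" .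
qed

end

theory Submission
  imports Defs
begin

text \<open>
  In the unitization of \<open>R\<close> let \<open>z = 1 - (1 - e\<^sub>1) (1 - e\<^sub>2) \<dots> (1 - e\<^sub>n)\<close>; expanding the product shows
  that \<open>z\<close> lies in \<open>R\<close> itself.  Modulo the ideal \<open>J\<close> generated by \<open>z\<close> the product becomes \<open>1\<close>.  But
  \<open>1 - e\<^sub>1\<close> is idempotent, so multiplying the product by it from the left changes nothing; hence
  \<open>1 - e\<^sub>1 = 1\<close> modulo \<open>J\<close>, that is, \<open>e\<^sub>1 \<in> J\<close>.  Then the product of the remaining factors is also \<open>1\<close>
  modulo \<open>J\<close>, and the argument repeats until all \<open>e\<^sub>i\<close> lie in \<open>J\<close>.  Since the \<open>e\<^sub>i\<close> generate \<open>R\<close>, this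
  gives \<open>J = R\<close>.
\<close>

text \<open>
  The circle operation \<open>x \<circ> y = x + y - x y\<close> is the product \<open>1 - (1 - x) (1 - y)\<close> written without a
  unit, and its iteration over a list is \<open>1 - (1 - x\<^sub>1) \<dots> (1 - x\<^sub>k)\<close>.
\<close>

definition circle :: "'r::ring \<Rightarrow> 'r \<Rightarrow> 'r"
  where "circle x y = x + y - x * y"

definition circle_list :: "'r::ring list \<Rightarrow> 'r"
  where "circle_list xs = foldr circle xs 0"

lemma two_sided_ideal_diff:
  "two_sided_ideal J \<Longrightarrow> x \<in> J \<Longrightarrow> y \<in> J \<Longrightarrow> x - y \<in> J"
  unfolding two_sided_ideal_def add_subgroup_def by (metis diff_conv_add_uminus)

text \<open>
  In the unitization \<open>1 - x\<close> absorbs a second factor \<open>1 - x\<close>, so \<open>(1 - x) (1 - x) (1 - y)\<close> equals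
  \<open>(1 - x) (1 - y)\<close>; the lemma is this equation without the unit.
\<close>

lemma idem_mult_circle: "x * x = x \<Longrightarrow> x * circle x y = x"
  by (simp add: circle_def algebra_simps flip: mult.assoc)

text \<open>
  The step that peels off one factor of the product: \<open>x \<in> J\<close> comes from multiplying the given member
  of \<open>J\<close> by \<open>x\<close>, and modulo \<open>x\<close> the element \<open>x \<circ> y\<close> is \<open>y\<close>.
\<close>

lemma circle_mem_ideal_imp:
  assumes J: "two_sided_ideal J" and x: "x * x = x" and mem: "circle x y \<in> J"
  shows "x \<in> J" and "y \<in> J"
proof -
  have "x * circle x y \<in> J"
    using J mem by (simp add: two_sided_ideal_def)
  then show xJ: "x \<in> J"
    by (simp add: idem_mult_circle x)
  have "x - x * y \<in> J"
    using J xJ by (simp add: two_sided_ideal_diff two_sided_ideal_def)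
  then have "circle x y - (x - x * y) \<in> J"
    using J mem by (simp add: two_sided_ideal_diff)
  then show "y \<in> J"
    by (simp add: circle_def)
qed

lemma circle_list_mem_ideal_imp:
  assumes "two_sided_ideal J" and "\<forall>x\<in>set xs. x * x = x" and "circle_list xs \<in> J"
  shows "set xs \<subseteq> J"
  using assms(2,3)
proof (induction xs)
  case (Cons x xs)
  then show ?case
    using circle_mem_ideal_imp[OF assms(1), of x "circle_list xs"] by (simp add: circle_list_def)
qed simp

lemma rng_eval_mem_ideal:
  assumes "two_sided_ideal J" and "e ` set_rng_expr s \<subseteq> J"
  shows "rng_eval e s \<in> J"
  using assms(2)
  by (induction s) (use assms(1) in \<open>auto simp: two_sided_ideal_def add_subgroup_def image_Un\<close>)

theorem corollary3:
  fixes n :: nat and e :: "nat \<Rightarrow> 'r::ring"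
  assumes "n \<ge> 1"
    and "free_rng_on_idempotents {1..n} e"
  shows "\<exists>z::'r. ideal_generated_by {z} = UNIV"
proof
  let ?xs = "map e [1..<Suc n]"
  let ?J = "ideal_generated_by {circle_list ?xs}"
  have J: "two_sided_ideal ?J"
    by (rule two_sided_ideal_ideal_generated_by)
  have "\<forall>x\<in>set ?xs. x * x = x"
    using free_rng_on_idempotents_idem[OF assms(2)] by auto
  moreover have "circle_list ?xs \<in> ?J"
    by (simp add: ideal_generated_by_smallest hull_inc)
  ultimately have "set ?xs \<subseteq> ?J"
    by (rule circle_list_mem_ideal_imp[OF J])
  then have gens: "e ` {1..n} \<subseteq> ?J"
    by (simp only: set_map set_upt atLeastLessThanSuc_atLeastAtMost)
  have "x \<in> ?J" for x
  proof -
    obtain s where "set_rng_expr s \<subseteq> {1..n}" and x: "x = rng_eval e s"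
      using assms(2) unfolding free_rng_on_idempotents_def by blast
    then have "e ` set_rng_expr s \<subseteq> ?J"
      using gens by blast
    then show ?thesis
      unfolding x by (rule rng_eval_mem_ideal[OF J])
  qed
  then show "?J = UNIV"
    by blast
qed

end
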